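(* For every integer $n\equiv 0\pmod 4$ with $n\geq 8$, there exists a circulant graph of order $n$ which is regular of degree $n-4$ and is doubly Eulerian (an edge-maximal doubly Eulerian circulant graph of order $n$).
   Context: All graphs are finite, simple and connected. A circulant graph of order $n$ is a Cayley graph on the cyclic group $\mathbb{Z}_n$. An Eulerian circuit is a closed trail traversing every edge exactly once. Let $G$ be Eulerian with $m$ edges and $u$ a vertex. Two Eulerian circuits $u,v_1,\ldots,v_{m-1},u$ and $u,w_1,\ldots,w_{m-1},u$ are avoiding if for every $1\le i\le m-1$, $v_i\neq w_i$ and $v_i$ is not adjacent to $w_i$. $G$ is doubly Eulerian if for every vertex $u$ there is a pair of avoiding Eulerian circuits starting and ending at $u$. For even $n$, a doubly Eulerian graph of order $n$ is edge-maximal if it is regular of degree $n-4$ (the maximum possible). *)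

theory Defs
  imports "HOL-Algebra.Elementary_Groups" "Graph_Theory.Graph_Theory"
begin

(* A finite simple graph is a pair_graph: its arc relation is symmetric and irreflexive, and
   every undirected edge {u, v} is represented by the two arcs (u, v) and (v, u). Hence
   out_degree is the usual degree, but edges and trails have to be taken with respect to
   unordered pairs. *)

definition edges :: "'a pair_pre_digraph \<Rightarrow> 'a set set" where
  "edges G = (\<lambda>(x, y). {x, y}) ` parcs G"

definition vwalk_edges :: "'a vwalk \<Rightarrow> 'a set list" where
  "vwalk_edges p = map (\<lambda>(x, y). {x, y}) (vwalk_arcs p)"

definition regular_graph :: "'a pair_pre_digraph \<Rightarrow> nat \<Rightarrow> bool" where
  "regular_graph G d \<longleftrightarrow> (\<forall>v \<in> pverts G. out_degree (with_proj G) v = d)"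

definition eulerian_circuit :: "'a pair_pre_digraph \<Rightarrow> 'a \<Rightarrow> 'a vwalk \<Rightarrow> bool" where
  "eulerian_circuit G u p \<longleftrightarrow>
     vwalk p (with_proj G) \<and> hd p = u \<and> last p = u \<and>
     distinct (vwalk_edges p) \<and> set (vwalk_edges p) = edges G"

definition eulerian :: "'a pair_pre_digraph \<Rightarrow> bool" where
  "eulerian G \<longleftrightarrow> (\<exists>u p. eulerian_circuit G u p)"

(* Meant for two Eulerian circuits p and q of G with the same initial vertex: these are lists of
   length m + 1, where m is the number of edges, and the positions 0 and m are exempt. *)

definition avoiding :: "'a pair_pre_digraph \<Rightarrow> 'a vwalk \<Rightarrow> 'a vwalk \<Rightarrow> bool" where
  "avoiding G p q \<longleftrightarrow>
     (\<forall>i. 1 \<le> i \<and> i < card (edges G) \<longrightarrow> p ! i \<noteq> q ! i \<and> (p ! i, q ! i) \<notin> parcs G)"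

definition doubly_eulerian :: "'a pair_pre_digraph \<Rightarrow> bool" where
  "doubly_eulerian G \<longleftrightarrow>
     pair_graph G \<and> Digraph_Component.connected (with_proj G) \<and> eulerian G \<and>
     (\<forall>u \<in> pverts G. \<exists>p q. eulerian_circuit G u p \<and> eulerian_circuit G u q \<and> avoiding G p q)"

definition cayley_graph :: "('a, 'b) monoid_scheme \<Rightarrow> 'a set \<Rightarrow> 'a pair_pre_digraph" where
  "cayley_graph \<Gamma> S =
     \<lparr> pverts = carrier \<Gamma>, parcs = {(g, g \<otimes>\<^bsub>\<Gamma>\<^esub> s) | g s. g \<in> carrier \<Gamma> \<and> s \<in> S} \<rparr>"

definition connection_set :: "('a, 'b) monoid_scheme \<Rightarrow> 'a set \<Rightarrow> bool" where
  "connection_set \<Gamma> S \<longleftrightarrow>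
     S \<subseteq> carrier \<Gamma> \<and> \<one>\<^bsub>\<Gamma>\<^esub> \<notin> S \<and> (\<forall>s \<in> S. inv\<^bsub>\<Gamma>\<^esub> s \<in> S)"

(* For n > 0 the carrier of integer_mod_group n is {0..<int n}. *)

definition circulant_graph :: "nat \<Rightarrow> int pair_pre_digraph \<Rightarrow> bool" where
  "circulant_graph n G \<longleftrightarrow>
     (\<exists>S. connection_set (integer_mod_group n) S \<and> G = cayley_graph (integer_mod_group n) S)"

end

theory Submission
  imports Defs
begin

text \<open>
  Write \<open>n = 4 * k\<close> and take all \<open>s\<close> not divisible by \<open>k\<close> as connection set. The resulting graph
  is the complete multipartite graph with \<open>k\<close> parts of size 4, the residue classes modulo \<open>k\<close>, so
  two circuits avoid each other iff at every inner step they are at distinct vertices of the same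
  part. Number the parts so that the starting vertex is in part 0. Between the parts 0 and 1 the
  edges form \<open>K\<^sub>4\<^sub>,\<^sub>4\<close>, for which an avoiding pair is written down explicitly. The remaining edges
  form a connected graph with an Eulerian orientation, hence carry an Eulerian circuit \<open>C\<close>. If \<open>\<rho>\<close>
  is the automorphism that rotates every part, then \<open>C\<close> and \<open>\<rho> C\<close> are in the same part but at
  distinct vertices at all steps, endpoints included. The explicit pair is after one step at a
  vertex \<open>c\<close> and at \<open>\<rho> c\<close>, respectively, and \<open>C\<close> and \<open>\<rho> C\<close> are spliced in there.
\<close>

section \<open>Edge lists of walks and Eulerian circuits\<close>

lemma vwalk_edges_simps [simp]:
  "vwalk_edges [] = []" "vwalk_edges [x] = []"
  "vwalk_edges (x # y # p) = {x, y} # vwalk_edges (y # p)"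
  by (simp_all add: vwalk_edges_def)

text \<open>The closed walk \<open>C\<close> takes the place of the vertex \<open>c\<close> in
  \<open>x # c # p\<close>: it is entered and left at \<open>c\<close>, so the old edges stay and
  those of \<open>C\<close> are added.\<close>

lemma vwalk_edges_splice:
  assumes "C \<noteq> []" "hd C = c" "last C = c" "p \<noteq> []"
  shows "vwalk_edges (x # C @ p) = {x, c} # vwalk_edges C @ vwalk_edges (c # p)"
  using assms by (simp add: vwalk_edges_def vwalk_arcs_append)

lemma vwalk_arcs_map: "vwalk_arcs (map f p) = map (map_prod f f) (vwalk_arcs p)"
  by (induct p rule: vwalk_arcs.induct) auto

lemma vwalk_edges_map: "vwalk_edges (map f p) = map (image f) (vwalk_edges p)"
  by (auto simp: vwalk_edges_def vwalk_arcs_map)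

lemma vwalk_arcs_pawalk_verts: "pcas u p v \<Longrightarrow> vwalk_arcs (pawalk_verts u p) = p"
proof (induct p arbitrary: u)
  case (Cons e p)
  then show ?case by (cases p) auto
qed simp

text \<open>With symmetric arcs, \<open>{x, y} \<in> edges G\<close> yields the arc
  \<open>(x, y)\<close> whichever way the edge is traversed, so the condition on the edges already
  makes \<open>p\<close> a walk.\<close>

lemma eulerian_circuitI:
  assumes "sym (parcs G)" "p \<noteq> []" "set p \<subseteq> pverts G" "hd p = u" "last p = u"
    "distinct (vwalk_edges p)" "set (vwalk_edges p) = edges G"
  shows "eulerian_circuit G u p"
proof -
  have "(x, y) \<in> parcs G" if "(x, y) \<in> set (vwalk_arcs p)" for x y
  proof -
    have "{x, y} \<in> edges G"
      using that by (force simp flip: assms(7) simp: vwalk_edges_def)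
    then show ?thesis
      using assms(1) by (auto simp: edges_def doubleton_eq_iff dest: symD)
  qed
  then show ?thesis
    using assms by (auto simp: eulerian_circuit_def vwalk_def)
qed

lemma eulerian_circuit_length:
  assumes "eulerian_circuit G u p"
  shows "length p = Suc (card (edges G))"
proof -
  have "card (edges G) = length (vwalk_edges p)"
    using assms by (metis eulerian_circuit_def distinct_card)
  also have "\<dots> = length p - 1"
    using vwalk_length_simp[of p] unfolding vwalk_length_def by (simp add: vwalk_edges_def)
  finally have "card (edges G) = length p - 1" .
  moreover have "p \<noteq> []"
    using assms by (simp add: eulerian_circuit_def vwalk_def)
  ultimately show ?thesis
    by (cases p) simp_all
qed

text \<open>Carries circuits from the coordinate model to the circulant graph. As \<open>f\<close>
  is injective on vertices, taking images is injective on edges, so the image walk repeats no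
  edge.\<close>

lemma eulerian_circuit_map:
  assumes p: "eulerian_circuit K u p" and wf: "parcs K \<subseteq> pverts K \<times> pverts K"
    and inj: "inj_on f (pverts K)"
    and G: "pverts G = f ` pverts K" "parcs G = map_prod f f ` parcs K"
  shows "eulerian_circuit G (f u) (map f p)"
proof -
  have [simp]: "p \<noteq> []" and V: "set p \<subseteq> pverts K" and A: "set (vwalk_arcs p) \<subseteq> parcs K"
    and ends: "hd p = u" "last p = u"
    and E: "distinct (vwalk_edges p)" "set (vwalk_edges p) = edges K"
    using p by (auto simp: eulerian_circuit_def vwalk_def)
  have "edges K \<subseteq> Pow (pverts K)"
    using wf by (auto simp: edges_def)
  then have "inj_on (image f) (edges K)"
    using inj_on_image_Pow[OF inj] by (rule inj_on_subset[rotated])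
  moreover have "edges G = image f ` edges K"
    by (simp add: edges_def G image_image case_prod_unfold)
  ultimately show ?thesis
    using V A E ends
    by (auto simp: eulerian_circuit_def vwalk_def vwalk_arcs_map vwalk_edges_map distinct_map
        hd_map last_map G)
qed

section \<open>The complete multipartite graph in coordinates, its rotation, and near and far
  edges\<close>

text \<open>The pair \<open>(i, q)\<close> stands for position \<open>q\<close> in part
  \<open>i\<close>.\<close>

definition multipartite :: "nat \<Rightarrow> (nat \<times> nat) pair_pre_digraph" where
  "multipartite k =
     \<lparr> pverts = {..<k} \<times> {..<4},
       parcs = {(x, y). x \<in> {..<k} \<times> {..<4} \<and> y \<in> {..<k} \<times> {..<4} \<and> fst x \<noteq> fst y} \<rparr>"

lemma multipartite_simps [simp]:
  "pverts (multipartite k) = {..<k} \<times> {..<4}"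
  "parcs (multipartite k) =
     {(x, y). x \<in> {..<k} \<times> {..<4} \<and> y \<in> {..<k} \<times> {..<4} \<and> fst x \<noteq> fst y}"
  by (simp_all add: multipartite_def)

text \<open>The case distinction, in place of addition modulo 4, keeps second coordinates from 4 on
  out of range. Thus the last equivalence in \<open>rotate_part_simps\<close> holds for every
  \<open>x\<close>.\<close>

definition rotate_part :: "nat \<times> nat \<Rightarrow> nat \<times> nat" where
  "rotate_part = map_prod id (\<lambda>q. if q = 3 then 0 else Suc q)"

lemma rotate_part_simps:
  "fst (rotate_part x) = fst x" "rotate_part x \<noteq> x" "inj_on rotate_part (UNIV \<times> {..<4})"
  "rotate_part x \<in> A \<times> {..<4} \<longleftrightarrow> x \<in> A \<times> {..<4}"
  by (cases x; auto simp: rotate_part_def inj_on_def split: if_splits)+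

lemma inj_on_rotate_part: "inj_on rotate_part ({..<k} \<times> {..<4})"
  using rotate_part_simps(3) by (rule inj_on_subset) auto

definition near_edges :: "(nat \<times> nat) set set" where
  "near_edges = {{(0, p), (1, q)} | p q. p < 4 \<and> q < 4}"

definition far_edges :: "nat \<Rightarrow> (nat \<times> nat) set set" where
  "far_edges k = {{x, y} | x y. x \<in> {..<k} \<times> {..<4} \<and> y \<in> {..<k} \<times> {..<4} \<and>
     fst x \<noteq> fst y \<and> \<not> {fst x, fst y} \<subseteq> {0, 1}}"

lemma far_edgesI:
  assumes "x \<in> {..<k} \<times> {..<4}" "y \<in> {..<k} \<times> {..<4}" "fst x \<noteq> fst y"
    "\<not> {fst x, fst y} \<subseteq> {0, 1}"
  shows "{x, y} \<in> far_edges k"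
  unfolding far_edges_def by (intro CollectI exI conjI) (rule refl assms)+

lemma far_edgesE:
  assumes "e \<in> far_edges k"
  obtains x y where "e = {x, y}" "x \<in> {..<k} \<times> {..<4}" "y \<in> {..<k} \<times> {..<4}"
    "fst x \<noteq> fst y" "\<not> {fst x, fst y} \<subseteq> {0, 1}"
  using assms unfolding far_edges_def by (elim CollectE exE conjE) (rule that)

lemma edges_eqI: "(x, y) \<in> parcs G \<Longrightarrow> e = {x, y} \<Longrightarrow> e \<in> edges G"
  unfolding edges_def by (rule image_eqI[of _ _ "(x, y)"]) simp_all

lemma edgesE:
  assumes "e \<in> edges G"
  obtains x y where "e = {x, y}" "(x, y) \<in> parcs G"
  using assms unfolding edges_def by auto

lemma edges_multipartite:
  assumes "k \<ge> 2"
  shows "edges (multipartite k) = near_edges \<union> far_edges k"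
proof (intro equalityI subsetI)
  fix e assume "e \<in> edges (multipartite k)"
  then obtain x y where e: "e = {x, y}" and "(x, y) \<in> parcs (multipartite k)"
    by (rule edgesE)
  then have xy: "x \<in> {..<k} \<times> {..<4}" "y \<in> {..<k} \<times> {..<4}" "fst x \<noteq> fst y"
    by simp_all
  show "e \<in> near_edges \<union> far_edges k"
  proof (cases "{fst x, fst y} \<subseteq> {0, 1}")
    case True
    then consider "fst x = 0" "fst y = 1" | "fst x = 1" "fst y = 0"
      using xy(3) by force
    then have "e = {(0, snd x), (1, snd y)} \<or> e = {(0, snd y), (1, snd x)}"
      unfolding e by cases (metis prod.collapse, metis prod.collapse insert_commute)
    moreover have "snd x < 4" "snd y < 4"
      using xy by (simp_all add: mem_Times_iff)
    ultimately show ?thesis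
      unfolding near_edges_def by blast
  next
    case False
    then show ?thesis
      unfolding e by (intro UnI2 far_edgesI xy)
  qed
next
  fix e assume "e \<in> near_edges \<union> far_edges k"
  then show "e \<in> edges (multipartite k)"
  proof
    assume "e \<in> near_edges"
    then obtain p q where "e = {(0, p), (1, q)}" "p < 4" "q < 4"
      unfolding near_edges_def by blast
    then show ?thesis
      using assms by (intro edges_eqI[of "(0, p)" "(1, q)"]) simp_all
  next
    assume "e \<in> far_edges k"
    then show ?thesis
      by (rule far_edgesE) (rule edges_eqI, simp_all)
  qed
qed

text \<open>The part numbers of the two ends tell the classes apart: only for near edges do both lie
  in \<open>{0, 1}\<close>.\<close>

lemma near_edges_disjoint_far_edges: "near_edges \<inter> far_edges k = {}"
proof (rule equals0I)
  fix e assume e: "e \<in> near_edges \<inter> far_edges k"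
  from IntD1[OF e] obtain p q where "e = {(0, p), (1, q)}"
    unfolding near_edges_def by (elim CollectE exE conjE)
  then have "fst ` e \<subseteq> {0, 1}"
    by simp
  with IntD2[OF e] show False
    by (elim far_edgesE) (simp only: image_insert image_empty not_True_eq_False)
qed

section \<open>A balanced orientation of the far edges and a circuit through them\<close>

text \<open>The parity makes each vertex have two successors and two predecessors in each adjacent part.\<close>

definition far_orientation :: "nat \<Rightarrow> (nat \<times> nat) pair_pre_digraph" where
  "far_orientation k =
     \<lparr> pverts = {..<k} \<times> {..<4},
       parcs = {(x, y). x \<in> {..<k} \<times> {..<4} \<and> y \<in> {..<k} \<times> {..<4} \<and>
         \<not> {fst x, fst y} \<subseteq> {0, 1} \<and>
         (fst x < fst y \<and> even (snd x + snd y) \<or> fst y < fst x \<and> odd (snd x + snd y))} \<rparr>"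

lemma far_orientation_simps [simp]:
  "pverts (far_orientation k) = {..<k} \<times> {..<4}"
  "(x, y) \<in> parcs (far_orientation k) \<longleftrightarrow>
     x \<in> {..<k} \<times> {..<4} \<and> y \<in> {..<k} \<times> {..<4} \<and> \<not> {fst x, fst y} \<subseteq> {0, 1} \<and>
     (fst x < fst y \<and> even (snd x + snd y) \<or> fst y < fst x \<and> odd (snd x + snd y))"
  by (simp_all add: far_orientation_def)

text \<open>Exchanging the ends reverses the comparison of the parts but keeps the parity of
  \<open>snd x + snd y\<close>, so either parity selects one of the two directions.\<close>

lemma far_orientation_total:
  assumes "x \<in> {..<k} \<times> {..<4}" "y \<in> {..<k} \<times> {..<4}" "fst x \<noteq> fst y"
    "\<not> {fst x, fst y} \<subseteq> {0, 1}"
  shows "(x, y) \<in> parcs (far_orientation k) \<or> (y, x) \<in> parcs (far_orientation k)"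
  unfolding far_orientation_simps insert_commute[of "fst y"] add.commute[of "snd y"]
  using assms nat_neq_iff by blast

lemma edges_far_orientation: "edges (far_orientation k) = far_edges k"
proof (intro equalityI subsetI)
  fix e assume "e \<in> edges (far_orientation k)"
  then obtain x y where e: "e = {x, y}" and "(x, y) \<in> parcs (far_orientation k)"
    by (rule edgesE)
  then show "e \<in> far_edges k"
    unfolding e far_orientation_simps by (intro far_edgesI) auto
next
  fix e assume "e \<in> far_edges k"
  then show "e \<in> edges (far_orientation k)"
  proof (rule far_edgesE)
    fix x y assume e: "e = {x, y}" and xy: "x \<in> {..<k} \<times> {..<4}" "y \<in> {..<k} \<times> {..<4}"
      "fst x \<noteq> fst y" "\<not> {fst x, fst y} \<subseteq> {0, 1}"
    show ?thesis
      using far_orientation_total[OF xy] by (elim disjE) (auto simp: e intro: edges_eqI simp del: far_orientation_simps)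
  qed
qed

lemma pair_fin_digraph_far_orientation: "pair_fin_digraph (far_orientation k)"
proof
  have "parcs (far_orientation k) \<subseteq> pverts (far_orientation k) \<times> pverts (far_orientation k)"
    by auto
  then show "finite (parcs (far_orientation k))"
    by (rule finite_subset) simp
qed auto

text \<open>Serves both the far orientation and the circulant graph, where any two vertices are
  adjacent or have a common neighbour once directions are ignored.\<close>

lemma connected_diameter_two:
  assumes "pverts G \<noteq> {}"
    and "\<And>x y. x \<in> pverts G \<Longrightarrow> y \<in> pverts G \<Longrightarrow>
      (x, y) \<in> (parcs G)\<^sup>s \<or> (\<exists>z \<in> pverts G. (x, z) \<in> (parcs G)\<^sup>s \<and> (z, y) \<in> (parcs G)\<^sup>s)"
  shows "Digraph_Component.connected (with_proj G)"
proof -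
  have "(x, y) \<in> rtrancl_on (pverts G) ((parcs G)\<^sup>s)" if "x \<in> pverts G" "y \<in> pverts G" for x y
    using assms(2)[OF that] that
    by (auto intro: rtrancl_on_into_rtrancl_on)
  then show ?thesis
    using assms(1) by (simp add: connected_conv)
qed

text \<open>Rotating \<open>y\<close> keeps its part and changes the parity of its second
  coordinate, which turns an arc \<open>(y, x)\<close> into an arc
  \<open>(x, rotate_part y)\<close>. So the rotation is a bijection from the predecessors of
  \<open>x\<close> to its successors.\<close>

lemma far_orientation_balanced:
  "in_degree (with_proj (far_orientation k)) x = out_degree (with_proj (far_orientation k)) x"
proof -
  let ?D = "far_orientation k" and ?V = "{..<k} \<times> {..<4::nat}"
  let ?In = "{y. (y, x) \<in> parcs ?D}" and ?Out = "{y. (x, y) \<in> parcs ?D}"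
  \<comment> \<open>The wrap from 3 to 0 changes the parity as well, because the parts have even
    size.\<close>
  have parity: "even (snd (rotate_part y)) \<longleftrightarrow> odd (snd y)" for y
    by (cases y) (simp add: rotate_part_def)
  note inj = inj_on_rotate_part[of k]
  have flip: "rotate_part y \<in> ?Out \<longleftrightarrow> y \<in> ?In" for y
    by (simp add: rotate_part_simps parity insert_commute) (auto simp: rotate_part_simps)
  have "rotate_part ` ?In = ?Out"
  proof
    show "?Out \<subseteq> rotate_part ` ?In"
    proof
      fix y assume y: "y \<in> ?Out"
      have "rotate_part ` ?V = ?V"
        using inj by (intro endo_inj_surj image_subsetI) (simp_all only: rotate_part_simps(4), simp)
      moreover have "y \<in> ?V"
        using y by simp
      ultimately obtain z where "y = rotate_part z"
        by (metis imageE)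
      then show "y \<in> rotate_part ` ?In"
        using y flip by blast
    qed
  qed (use flip in blast)
  moreover have "inj_on rotate_part ?In"
    using inj by (rule inj_on_subset) auto
  ultimately have "card ?In = card ?Out"
    using card_image by fastforce
  moreover have "in_arcs (with_proj ?D) x = (\<lambda>y. (y, x)) ` ?In"
    "out_arcs (with_proj ?D) x = (\<lambda>y. (x, y)) ` ?Out"
    by (auto simp: in_arcs_def out_arcs_def simp del: far_orientation_simps)
  ultimately show ?thesis
    by (simp add: in_degree_def out_degree_def card_image inj_on_def del: far_orientation_simps)
qed

lemma far_orientation_connected:
  assumes "k \<ge> 3"
  shows "Digraph_Component.connected (with_proj (far_orientation k))"
proof -
  let ?V = "{..<k} \<times> {..<4::nat}" and ?R = "(parcs (far_orientation k))\<^sup>s"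
  have adj: "(x, y) \<in> ?R"
    if "x \<in> ?V" "y \<in> ?V" "fst x \<noteq> fst y" "\<not> {fst x, fst y} \<subseteq> {0, 1}" for x y
    using far_orientation_total[OF that]
    by (elim disjE) (force simp: symcl_def simp del: far_orientation_simps)+
  have "(x, y) \<in> ?R \<or> (\<exists>z \<in> ?V. (x, z) \<in> ?R \<and> (z, y) \<in> ?R)" if "x \<in> ?V" "y \<in> ?V" for x y
  proof (cases "fst x = fst y \<or> {fst x, fst y} \<subseteq> {0, 1}")
    case False
    with that show ?thesis by (intro disjI1 adj) auto
  next
    case True
    \<comment> \<open>A common neighbour. If \<open>x\<close> is in a part from 2 on, then
      \<open>y\<close> is in the same part and part 0 is adjacent to it; otherwise both are in parts
      0 and 1, and part 2 exists as \<open>k \<ge> 3\<close>.\<close>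
    define z :: "nat \<times> nat" where "z = (if fst x \<ge> 2 then (0, 0) else (2, 0))"
    have z: "z \<in> ?V"
      using assms by (simp add: z_def)
    have ne: "fst x \<noteq> fst z" "fst z \<noteq> fst y"
      "\<not> {fst x, fst z} \<subseteq> {0, 1}" "\<not> {fst z, fst y} \<subseteq> {0, 1}"
      using True by (auto simp: z_def)
    show ?thesis
      using z adj[OF that(1) z ne(1,3)] adj[OF z that(2) ne(2,4)] by (intro disjI2 bexI conjI)
  qed
  moreover have "?V \<noteq> {}"
    using assms by (simp add: Sigma_empty_iff lessThan_empty_iff)
  ultimately show ?thesis
    by (intro connected_diameter_two) (simp_all only: far_orientation_simps not_False_eq_True)
qed

text \<open>A connected balanced digraph has a closed Euler trail; forgetting the directions of the
  far orientation gives the circuit. For \<open>k = 2\<close> there are no far edges and a single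
  vertex suffices.\<close>

lemma far_circuit:
  assumes "k \<ge> 2"
  obtains C where "C \<noteq> []" "hd C = (1, 0)" "last C = (1, 0)" "set C \<subseteq> {..<k} \<times> {..<4}"
    "distinct (vwalk_edges C)" "set (vwalk_edges C) = far_edges k"
proof (cases "k = 2")
  case True
  have "far_edges k = {}"
  proof (rule equals0I)
    fix e assume "e \<in> far_edges k"
    then show False
    proof (rule far_edgesE)
      fix x y :: "nat \<times> nat"
      assume "x \<in> {..<k} \<times> {..<4}" "y \<in> {..<k} \<times> {..<4}"
      then have "fst x < 2" "fst y < 2"
        using True by auto
      moreover assume "\<not> {fst x, fst y} \<subseteq> {0, 1}"
      ultimately show False
        by (simp add: less_2_cases_iff)
    qed
  qed
  then show ?thesis
    using True by (intro that[of "[(1, 0)]"]) auto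
next
  case False
  let ?D = "far_orientation k"
  interpret pair_fin_digraph ?D
    by (rule pair_fin_digraph_far_orientation)
  have k: "k \<ge> 3"
    using False assms by simp
  obtain u p where p: "euler_trail u p u"
    using closed_euler1[OF far_orientation_connected[OF k] far_orientation_balanced]
    by (elim exE)
  then have "trail u p u" and "(1, 0) \<in> set (pawalk_verts u p)"
    using k unfolding euler_trail_def by simp_all
  \<comment> \<open>The trail visits all vertices, so it can be rotated to start at
    \<open>(1, 0)\<close>, where it will be inserted into the first near circuit.\<close>
  then obtain q where "trail (1, 0) q (1, 0)" "set q = set p"
    by (rule rotate_trailE')
  then have q: "awalk (1, 0) q (1, 0)" "distinct q" "set q = parcs ?D"
    using p unfolding euler_trail_def trail_def by simp_all
  let ?C = "pawalk_verts (1, 0) q"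
  have "vwalk_arcs ?C = q"
    using q(1) vwalk_arcs_pawalk_verts[of "(1, 0)" q "(1, 0)"] unfolding awalk_def by simp
  then have E: "vwalk_edges ?C = map (\<lambda>(x, y). {x, y}) q"
    by (simp add: vwalk_edges_def)
  show ?thesis
  proof (rule that)
    show "set (vwalk_edges ?C) = far_edges k"
      unfolding E set_map q(3) edges_far_orientation[symmetric] edges_def ..
    \<comment> \<open>No arc occurs together with its reverse, so each far edge comes from a single
      arc and a trail with distinct arcs has distinct edges.\<close>
    have "inj_on (\<lambda>(x, y). {x, y}) (parcs ?D)"
    proof (rule inj_onI)
      fix d e assume de: "d \<in> parcs ?D" "e \<in> parcs ?D"
        "(case d of (x, y) \<Rightarrow> {x, y}) = (case e of (x, y) \<Rightarrow> {x, y})"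
      obtain x y where d: "d = (x, y)"
        by (cases d)
      then have "e = (x, y) \<or> e = (y, x)"
        using de(3) by (cases e) (auto simp: doubleton_eq_iff)
      moreover have "(y, x) \<notin> parcs ?D"
        using de(1) unfolding d far_orientation_simps by (auto simp: add.commute)
      ultimately show "d = e"
        using d de(2) by metis
    qed
    then show "distinct (vwalk_edges ?C)"
      unfolding E distinct_map q(3) using q(2) by simp
    show "set ?C \<subseteq> {..<k} \<times> {..<4}"
      using q(1) unfolding awalk_conv far_orientation_simps by (elim conjE)
    show "hd ?C = (1, 0)" "last ?C = (1, 0)"
      using awhd_of_awalk[OF q(1)] awlast_of_awalk[OF q(1)] by simp_all
    show "?C \<noteq> []"
      by (cases q) simp_all
  qed
qed

section \<open>An avoiding pair in the complete multipartite graph\<close>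

text \<open>The continuations of the walks that start with \<open>(0, 0), (1, 0)\<close> and \<open>(0, 0), (1, 1)\<close> to an
  avoiding pair between the parts 0 and 1; found by a backtracking search.\<close>

definition near_tail1 :: "(nat \<times> nat) list" where
  "near_tail1 = [(0,1),(1,1),(0,0),(1,2),(0,1),(1,3),(0,2),(1,0),(0,3),(1,1),(0,2),(1,2),(0,3),(1,3)]"

definition near_tail2 :: "(nat \<times> nat) list" where
  "near_tail2 = [(0,2),(1,0),(0,1),(1,1),(0,3),(1,0),(0,0),(1,3),(0,1),(1,2),(0,3),(1,3),(0,2),(1,2)]"

text \<open>The sixteen edges are spelled out so that simplification can compare them with the edges
  of the explicit walks.\<close>

lemma near_edges_list:
  "near_edges = {{(0, 0), (1, 0)}, {(0, 0), (1, 1)}, {(0, 0), (1, 2)}, {(0, 0), (1, 3)},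
    {(0, 1), (1, 0)}, {(0, 1), (1, 1)}, {(0, 1), (1, 2)}, {(0, 1), (1, 3)},
    {(0, 2), (1, 0)}, {(0, 2), (1, 1)}, {(0, 2), (1, 2)}, {(0, 2), (1, 3)},
    {(0, 3), (1, 0)}, {(0, 3), (1, 1)}, {(0, 3), (1, 2)}, {(0, 3), (1, 3)}}"
proof -
  have "near_edges = (\<Union>p\<in>{..<4}. \<Union>q\<in>{..<4}. {{(0, p), (1, q)}})"
    unfolding near_edges_def
    by (simp only: set_eq_iff[where 'a = "(nat \<times> nat) set"] UN_iff mem_Collect_eq lessThan_iff
        singleton_iff) blast
  also have "{..<4::nat} = {0, 1, 2, 3}"
    by auto
  finally show ?thesis
    by (simp only: UN_insert UN_empty Un_insert_left Un_empty_left Un_empty_right)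
qed

lemma near_circuit1:
  "distinct (vwalk_edges ((0, 0) # (1, 0) # near_tail1 @ [(0, 0)]))"
  "set (vwalk_edges ((0, 0) # (1, 0) # near_tail1 @ [(0, 0)])) = near_edges"
  by (simp add: near_tail1_def doubleton_eq_iff,
      simp add: near_tail1_def near_edges_list insert_commute)

lemma near_circuit2:
  "distinct (vwalk_edges ((0, 0) # (1, 1) # near_tail2 @ [(0, 0)]))"
  "set (vwalk_edges ((0, 0) # (1, 1) # near_tail2 @ [(0, 0)])) = near_edges"
  by (simp add: near_tail2_def doubleton_eq_iff,
      simp add: near_tail2_def near_edges_list insert_commute)

text \<open>Inserting \<open>C\<close> at \<open>c\<close> adds the far edges to a circuit of the
  near edges, and these two disjoint classes make up all edges. The grouping \<open>C @ p\<close>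
  isolates the inner vertices of the circuit.\<close>

lemma multipartite_circuitI:
  assumes "k \<ge> 2" "c \<in> {1} \<times> {..<4}"
    and C: "C \<noteq> []" "hd C = c" "last C = c" "set C \<subseteq> {..<k} \<times> {..<4}"
      "distinct (vwalk_edges C)" "set (vwalk_edges C) = far_edges k"
    and p: "set p \<subseteq> {..<2} \<times> {..<4}" "distinct (vwalk_edges ((0, 0) # c # p @ [(0, 0)]))"
      "set (vwalk_edges ((0, 0) # c # p @ [(0, 0)])) = near_edges"
  shows "eulerian_circuit (multipartite k) (0, 0) ((0, 0) # (C @ p) @ [(0, 0)])"
proof (rule eulerian_circuitI)
  note splice = vwalk_edges_splice[OF C(1-3), of "p @ [(0, 0)]" "(0, 0)"]
  show "set (vwalk_edges ((0, 0) # (C @ p) @ [(0, 0)])) = edges (multipartite k)"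
    using p(3) C(6) by (auto simp: splice edges_multipartite[OF assms(1)])
  show "distinct (vwalk_edges ((0, 0) # (C @ p) @ [(0, 0)]))"
    using p(2,3) C(5,6) near_edges_disjoint_far_edges[of k] by (auto simp: splice)
  show "set ((0, 0) # (C @ p) @ [(0, 0)]) \<subseteq> pverts (multipartite k)"
    using assms(1) C(4) p(1) by auto
qed (auto simp: sym_def)

lemma far_edges_subset: "far_edges k \<subseteq> Pow ({..<k} \<times> {..<4})"
proof
  fix e assume "e \<in> far_edges k"
  then show "e \<in> Pow ({..<k} \<times> {..<4})"
    by (rule far_edgesE) (simp only: Pow_iff insert_subset empty_subsetI simp_thms)
qed

lemma inj_on_rotate_far_edges: "inj_on (image rotate_part) (far_edges k)"
  using inj_on_image_Pow[OF inj_on_rotate_part] far_edges_subset by (rule inj_on_subset)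

text \<open>Ensures that the rotated far circuit again covers exactly the far edges. Rotation
  respects parts, hence maps far edges to far edges, and an injective map of a finite set into
  itself is onto.\<close>

lemma rotate_part_far_edges: "image rotate_part ` far_edges k = far_edges k"
proof (rule endo_inj_surj[OF _ _ inj_on_rotate_far_edges])
  show "finite (far_edges k)"
    using far_edges_subset by (rule finite_subset) simp
  show "image rotate_part ` far_edges k \<subseteq> far_edges k"
  proof (rule image_subsetI)
    fix e assume "e \<in> far_edges k"
    then show "rotate_part ` e \<in> far_edges k"
    proof (rule far_edgesE)
      fix x y assume "e = {x, y}" "x \<in> {..<k} \<times> {..<4}" "y \<in> {..<k} \<times> {..<4}"
        "fst x \<noteq> fst y" "\<not> {fst x, fst y} \<subseteq> {0, 1}"
      then show ?thesis
        using far_edgesI[of "rotate_part x" k "rotate_part y"]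
        by (simp only: image_insert image_empty rotate_part_simps(1,4) not_False_eq_True)
    qed
  qed
qed

text \<open>The exempt end vertices are split off, so that avoidance becomes a relation between
  entries of \<open>M\<close> and \<open>N\<close>: distinct and non-adjacent means distinct within
  one part.\<close>

lemma multipartite_avoiding_circuits:
  assumes "k \<ge> 2"
  obtains M N where
    "eulerian_circuit (multipartite k) (0, 0) ((0, 0) # M @ [(0, 0)])"
    "eulerian_circuit (multipartite k) (0, 0) ((0, 0) # N @ [(0, 0)])"
    "set M \<subseteq> {..<k} \<times> {..<4}" "set N \<subseteq> {..<k} \<times> {..<4}"
    "list_all2 (\<lambda>x y. fst x = fst y \<and> x \<noteq> y) M N"
proof -
  obtain C where C: "C \<noteq> []" "hd C = (1, 0)" "last C = (1, 0)" "set C \<subseteq> {..<k} \<times> {..<4}"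
    "distinct (vwalk_edges C)" "set (vwalk_edges C) = far_edges k"
    using far_circuit[OF assms] by blast
  let ?D = "map rotate_part C"
  have D: "distinct (vwalk_edges ?D)" "set (vwalk_edges ?D) = far_edges k"
    using C(5,6) inj_on_rotate_far_edges[of k]
    by (simp_all add: vwalk_edges_map distinct_map rotate_part_far_edges)
  have D': "set ?D \<subseteq> {..<k} \<times> {..<4}"
    unfolding set_map using C(4)
    by (intro image_subsetI) (simp only: rotate_part_simps(4) subset_iff)
  \<comment> \<open>The rotated circuit is based at \<open>(1, 1)\<close>, the second vertex of the
    second near circuit.\<close>
  have ends: "hd ?D = (1, 1)" "last ?D = (1, 1)"
    using C(1-3) by (simp_all add: hd_map last_map rotate_part_def)
  have near: "set near_tail1 \<subseteq> {..<2} \<times> {..<4}" "set near_tail2 \<subseteq> {..<2} \<times> {..<4}"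
    by (simp_all add: near_tail1_def near_tail2_def)
  show ?thesis
  proof (rule that)
    show "eulerian_circuit (multipartite k) (0, 0) ((0, 0) # (C @ near_tail1) @ [(0, 0)])"
      by (rule multipartite_circuitI[OF assms _ C near(1) near_circuit1]) simp
    show "eulerian_circuit (multipartite k) (0, 0) ((0, 0) # (?D @ near_tail2) @ [(0, 0)])"
      by (rule multipartite_circuitI[OF assms _ _ ends D' D near(2) near_circuit2])
        (use C(1) in simp_all)
    have "list_all2 (\<lambda>x y. fst x = fst y \<and> x \<noteq> y) C ?D"
      by (simp add: list_all2_map2 list_all2_same rotate_part_simps rotate_part_simps(2)[symmetric])
    \<comment> \<open>\<open>C\<close> and its rotation have equal length, so the two tails stay
      aligned and are compared entry by entry.\<close>
    then show "list_all2 (\<lambda>x y. fst x = fst y \<and> x \<noteq> y) (C @ near_tail1) (?D @ near_tail2)"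
      by (intro list_all2_appendI) (simp_all add: near_tail1_def near_tail2_def)
  qed (use assms C(4) D' near in auto)
qed

section \<open>The multipartite graph on residues as a circulant graph\<close>

definition residue_multipartite :: "nat \<Rightarrow> int pair_pre_digraph" where
  "residue_multipartite k =
     \<lparr> pverts = {0..<4 * int k},
       parcs = {(x, y). x \<in> {0..<4 * int k} \<and> y \<in> {0..<4 * int k} \<and>
         x mod int k \<noteq> y mod int k} \<rparr>"

lemma residue_multipartite_simps [simp]:
  "pverts (residue_multipartite k) = {0..<4 * int k}"
  "parcs (residue_multipartite k) =
     {(x, y). x \<in> {0..<4 * int k} \<and> y \<in> {0..<4 * int k} \<and> x mod int k \<noteq> y mod int k}"
  by (simp_all add: residue_multipartite_def)

text \<open>Reduction modulo \<open>4 * k\<close> preserves residues modulo \<open>k\<close>. Hence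
  adding \<open>s\<close> changes the class modulo \<open>k\<close> exactly when \<open>k\<close>
  does not divide \<open>s\<close>.\<close>

lemma circulant_residue_multipartite:
  assumes "k > 0"
  shows "circulant_graph (4 * k) (residue_multipartite k)"
proof -
  let ?Z = "integer_mod_group (4 * k)" and ?n = "4 * int k"
  let ?S = "{s \<in> {0..<?n}. \<not> int k dvd s}"
  have car: "carrier ?Z = {0..<?n}" and mult: "x \<otimes>\<^bsub>?Z\<^esub> y = (x + y) mod ?n" for x y
    using assms by (simp_all add: carrier_integer_mod_group)
  have mod_n: "(x mod ?n) mod int k = x mod int k" for x
    by (simp add: mod_mod_cancel)
  have dvd_mod: "int k dvd x mod ?n \<longleftrightarrow> int k dvd x" for x
    by (simp add: dvd_mod_iff)
  have "connection_set ?Z ?S"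
    unfolding connection_set_def
  proof (intro conjI ballI)
    fix s assume s: "s \<in> ?S"
    then have "inv\<^bsub>?Z\<^esub> s = (- s) mod ?n"
      by (simp add: car)
    then show "inv\<^bsub>?Z\<^esub> s \<in> ?S"
      using s assms by (simp add: dvd_mod)
  qed (auto simp: car)
  moreover have "residue_multipartite k = cayley_graph ?Z ?S"
  proof -
    have arc: "(x, y) \<in> parcs (residue_multipartite k) \<longleftrightarrow>
      (\<exists>s. y = (x + s) mod ?n \<and> x \<in> {0..<?n} \<and> s \<in> ?S)" (is "?l \<longleftrightarrow> ?r") for x y
    proof
      assume ?l
      then have "x \<in> {0..<?n}" "y \<in> {0..<?n}" "\<not> int k dvd y - x"
        by (simp_all add: mod_eq_dvd_iff dvd_diff_commute)
      then have "y = (x + (y - x) mod ?n) mod ?n \<and> x \<in> {0..<?n} \<and> (y - x) mod ?n \<in> ?S"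
        using assms by (simp add: dvd_mod mod_add_right_eq)
      then show ?r ..
    next
      assume ?r
      then obtain s where "y = (x + s) mod ?n" "x \<in> {0..<?n}" "\<not> int k dvd s"
        by blast
      moreover from this(1) have "x mod int k = y mod int k \<longleftrightarrow> int k dvd s"
        by (simp add: mod_n mod_eq_dvd_iff)
      ultimately show ?l
        using assms by simp
    qed
    have "parcs (residue_multipartite k) =
      {(x, (x + s) mod ?n) | x s. x \<in> {0..<?n} \<and> s \<in> ?S}"
    proof (rule Set.set_eqI)
      fix e :: "int \<times> int"
      obtain x y where "e = (x, y)"
        by (cases e)
      then show "e \<in> parcs (residue_multipartite k) \<longleftrightarrow>
        e \<in> {(x, (x + s) mod ?n) | x s. x \<in> {0..<?n} \<and> s \<in> ?S}"
        using arc[of x y] by (simp only: mem_Collect_eq prod.inject) blast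
    qed
    then show ?thesis
      unfolding cayley_graph_def car mult by (intro pair_pre_digraph.equality) simp_all
  qed
  ultimately show ?thesis
    unfolding circulant_graph_def by blast
qed

section \<open>Coordinates centred at a vertex\<close>

text \<open>The offset \<open>u\<close> sends \<open>(0, 0)\<close> to \<open>u\<close>, so that one
  avoiding pair based at \<open>(0, 0)\<close> serves every start vertex. Part \<open>i\<close>
  becomes the residue class of \<open>u + i\<close> modulo \<open>k\<close>.\<close>

definition vertex_from :: "nat \<Rightarrow> int \<Rightarrow> nat \<times> nat \<Rightarrow> int" where
  "vertex_from k u x = (u + int (fst x) + int k * int (snd x)) mod (4 * int k)"

lemma vertex_from_mod:
  "vertex_from k u x mod int k = (u + int (fst x)) mod int k"
  by (simp add: vertex_from_def mod_mod_cancel)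

lemma vertex_from_mod_eq_iff:
  assumes "fst x < k" "fst y < k"
  shows "vertex_from k u x mod int k = vertex_from k u y mod int k \<longleftrightarrow> fst x = fst y"
proof
  assume "vertex_from k u x mod int k = vertex_from k u y mod int k"
  then have "int k dvd int (fst x) - int (fst y)"
    by (simp add: vertex_from_mod mod_eq_dvd_iff)
  then show "fst x = fst y"
    using assms dvd_imp_le_int[of "int (fst x) - int (fst y)" "int k"] by linarith
qed (simp add: vertex_from_mod)

text \<open>The residue modulo \<open>k\<close> determines the first coordinate; after cancelling
  \<open>k\<close>, the residue modulo 4 determines the second.\<close>

lemma vertex_from_inj: "inj_on (vertex_from k u) ({..<k} \<times> {..<4})"
proof (rule inj_onI)
  fix x y assume xy: "x \<in> {..<k} \<times> {..<4::nat}" "y \<in> {..<k} \<times> {..<4::nat}"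
    and eq: "vertex_from k u x = vertex_from k u y"
  then have lt: "fst x < k" "fst y < k" "snd x < 4" "snd y < 4"
    by (simp_all add: mem_Times_iff)
  have fst: "fst x = fst y"
    using eq vertex_from_mod_eq_iff[OF lt(1,2)] by metis
  then have "4 * int k dvd int k * int (snd x) - int k * int (snd y)"
    using eq by (simp add: vertex_from_def mod_eq_dvd_iff)
  then have "int k * 4 dvd int k * (int (snd x) - int (snd y))"
    by (simp add: right_diff_distrib mult.commute)
  then have "4 dvd int (snd x) - int (snd y)"
    using lt by simp
  then have "snd x = snd y"
    using lt by presburger
  with fst show "x = y"
    by (simp add: prod_eq_iff)
qed

lemma vertex_from_image: "k > 0 \<Longrightarrow> vertex_from k u ` ({..<k} \<times> {..<4}) = {0..<4 * int k}"
proof (rule card_subset_eq)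
  show "card (vertex_from k u ` ({..<k} \<times> {..<4})) = card {0..<4 * int k}"
    by (simp add: card_image[OF vertex_from_inj] card_cartesian_product)
qed (auto simp: vertex_from_def)

lemma vertex_from_arcs:
  assumes "k > 0"
  shows "parcs (residue_multipartite k) =
    map_prod (vertex_from k u) (vertex_from k u) ` parcs (multipartite k)" (is "_ = ?r")
proof
  show "?r \<subseteq> parcs (residue_multipartite k)"
    using vertex_from_image[OF assms, of u] by (auto simp: vertex_from_mod_eq_iff)
  show "parcs (residue_multipartite k) \<subseteq> ?r"
  proof
    fix e assume e: "e \<in> parcs (residue_multipartite k)"
    then have "fst e \<in> vertex_from k u ` ({..<k} \<times> {..<4})"
      "snd e \<in> vertex_from k u ` ({..<k} \<times> {..<4})"
      unfolding vertex_from_image[OF assms] by auto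
    then obtain x y where xy: "x \<in> {..<k} \<times> {..<4}" "y \<in> {..<k} \<times> {..<4}"
      "e = map_prod (vertex_from k u) (vertex_from k u) (x, y)"
      by (cases e) auto
    then have "fst x \<noteq> fst y"
      using e by (auto simp: vertex_from_mod)
    then show "e \<in> ?r"
      using xy by (auto intro!: image_eqI[of _ _ "(x, y)"])
  qed
qed

lemma vertex_from_0: "u \<in> {0..<4 * int k} \<Longrightarrow> vertex_from k u (0, 0) = u"
  by (simp add: vertex_from_def)

section \<open>Degree and connectedness of the circulant graph\<close>

text \<open>In coordinates centred at \<open>u\<close>, the vertex \<open>u\<close> lies in part 0
  and its neighbours are the vertices of the other \<open>k - 1\<close> parts of size 4.\<close>

lemma regular_residue_multipartite:
  assumes "k > 0"
  shows "regular_graph (residue_multipartite k) (4 * k - 4)"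
proof -
  have "out_degree (with_proj (residue_multipartite k)) u = 4 * k - 4"
    if u: "u \<in> {0..<4 * int k}" for u
  proof -
    let ?f = "vertex_from k u" and ?N = "({..<k} - {0}) \<times> {..<4::nat}"
    have 0: "fst (0, 0) < k" "?f (0, 0) = u"
      using assms u by (simp_all add: vertex_from_0)
    have adj: "(u, ?f x) \<in> parcs (residue_multipartite k) \<longleftrightarrow> x \<in> ?N"
      if "x \<in> {..<k} \<times> {..<4}" for x
    proof -
      have "fst x < k" "?f x \<in> {0..<4 * int k}"
        using that imageI[OF that, of ?f] unfolding vertex_from_image[OF assms]
        by (simp_all add: mem_Times_iff)
      then show ?thesis
        using vertex_from_mod_eq_iff[OF 0(1), of x u] that u unfolding 0(2)
        by (simp add: mem_Times_iff)
    qed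
    have arcs: "out_arcs (with_proj (residue_multipartite k)) u = (\<lambda>x. (u, ?f x)) ` ?N"
    proof (intro equalityI subsetI)
      fix e assume "e \<in> out_arcs (with_proj (residue_multipartite k)) u"
      then obtain y where e: "(u, y) \<in> parcs (residue_multipartite k)" "e = (u, y)"
        by (cases e) (simp add: out_arcs_def)
      then have "y \<in> ?f ` ({..<k} \<times> {..<4})"
        unfolding vertex_from_image[OF assms] by simp
      then obtain x where y: "y = ?f x" and x: "x \<in> {..<k} \<times> {..<4}"
        by (rule imageE)
      from e(2) have "e = (u, ?f x)"
        by (simp only: y)
      moreover have "x \<in> ?N"
        using adj[OF x] e(1) by (simp only: y)
      ultimately show "e \<in> (\<lambda>x. (u, ?f x)) ` ?N"
        by (rule image_eqI)
    next
      fix e assume "e \<in> (\<lambda>x. (u, ?f x)) ` ?N"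
      then obtain x where "x \<in> ?N" "e = (u, ?f x)"
        by (rule imageE)
      then show "e \<in> out_arcs (with_proj (residue_multipartite k)) u"
        using adj[of x] by (simp add: mem_Times_iff out_arcs_def del: residue_multipartite_simps)
    qed
    have "inj_on ?f ?N"
      using vertex_from_inj by (rule inj_on_subset) auto
    then have inj: "inj_on (\<lambda>x. (u, ?f x)) ?N"
      by (simp only: inj_on_def prod.inject simp_thms)
    have "out_degree (with_proj (residue_multipartite k)) u = card ?N"
      unfolding out_degree_def arcs card_image[OF inj] ..
    also have "\<dots> = card ({..<k} - {0}) * card {..<4::nat}"
      by (rule card_cartesian_product)
    also have "\<dots> = 4 * k - 4"
      using assms by (cases k) simp_all
    finally show ?thesis .
  qed
  then show ?thesis
    unfolding regular_graph_def residue_multipartite_simps by (rule ballI)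
qed

lemma pair_graph_residue_multipartite: "pair_graph (residue_multipartite k)"
proof
  have "parcs (residue_multipartite k) \<subseteq> {0..<4 * int k} \<times> {0..<4 * int k}"
    by auto
  then show "finite (parcs (residue_multipartite k))"
    by (rule finite_subset) simp
  show "symmetric (with_proj (residue_multipartite k))"
    by (auto simp: symmetric_def sym_def)
qed auto

lemma connected_residue_multipartite:
  assumes "k \<ge> 2"
  shows "Digraph_Component.connected (with_proj (residue_multipartite k))"
proof (rule connected_diameter_two)
  let ?G = "residue_multipartite k" and ?n = "4 * int k"
  have adj: "(x, y) \<in> (parcs ?G)\<^sup>s"
    if "x \<in> {0..<?n}" "y \<in> {0..<?n}" "x mod int k \<noteq> y mod int k" for x y
    using that unfolding symcl_def by simp
  show "pverts ?G \<noteq> {}"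
    using assms by simp
  fix x y assume "x \<in> pverts ?G" "y \<in> pverts ?G"
  then have xy: "x \<in> {0..<?n}" "y \<in> {0..<?n}"
    by simp_all
  show "(x, y) \<in> (parcs ?G)\<^sup>s \<or>
    (\<exists>z\<in>pverts ?G. (x, z) \<in> (parcs ?G)\<^sup>s \<and> (z, y) \<in> (parcs ?G)\<^sup>s)"
  proof (cases "x mod int k = y mod int k")
    case False
    then show ?thesis
      using adj[OF xy] by (intro disjI1)
  next
    case True
    \<comment> \<open>The class of \<open>x + 1\<close> modulo \<open>k\<close> differs from the
      common class of \<open>x\<close> and \<open>y\<close> because \<open>k \<ge> 2\<close>, so
      \<open>z\<close> is adjacent to both.\<close>
    define z where "z = (x + 1) mod ?n"
    have z: "z \<in> {0..<?n}"
      using assms by (simp add: z_def)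
    have "z mod int k = (x + 1) mod int k"
      by (simp add: z_def mod_mod_cancel)
    moreover have "(x + 1) mod int k \<noteq> x mod int k"
      using assms by (simp add: mod_eq_dvd_iff)
    ultimately have ne: "x mod int k \<noteq> z mod int k" "z mod int k \<noteq> y mod int k"
      using True by simp_all
    show ?thesis
      using z adj[OF xy(1) z ne(1)] adj[OF z xy(2) ne(2)]
      by (intro disjI2 bexI[of _ z] conjI) simp_all
  qed
qed

section \<open>Transport of the avoiding pair and conclusion\<close>

lemma residue_multipartite_avoiding_circuits:
  assumes "k \<ge> 2" "u \<in> {0..<4 * int k}"
  obtains p q where "eulerian_circuit (residue_multipartite k) u p"
    "eulerian_circuit (residue_multipartite k) u q" "avoiding (residue_multipartite k) p q"
proof -
  let ?G = "residue_multipartite k" and ?f = "vertex_from k u"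
  obtain M N where M: "eulerian_circuit (multipartite k) (0, 0) ((0, 0) # M @ [(0, 0)])"
    and N: "eulerian_circuit (multipartite k) (0, 0) ((0, 0) # N @ [(0, 0)])"
    and V: "set M \<subseteq> {..<k} \<times> {..<4}" "set N \<subseteq> {..<k} \<times> {..<4}"
    and R: "list_all2 (\<lambda>x y. fst x = fst y \<and> x \<noteq> y) M N"
    by (rule multipartite_avoiding_circuits[OF assms(1)])
  let ?p = "map ?f ((0, 0) # M @ [(0, 0)])" and ?q = "map ?f ((0, 0) # N @ [(0, 0)])"
  have circuit: "eulerian_circuit ?G u (map ?f p)"
    if "eulerian_circuit (multipartite k) (0, 0) p" for p
  proof -
    have "eulerian_circuit ?G (?f (0, 0)) (map ?f p)"
      using that
    proof (rule eulerian_circuit_map)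
      show "pverts ?G = ?f ` pverts (multipartite k)"
        using vertex_from_image[of k u] assms(1) by simp
      show "parcs ?G = map_prod ?f ?f ` parcs (multipartite k)"
        using assms(1) by (intro vertex_from_arcs) simp
      show "inj_on ?f (pverts (multipartite k))"
        unfolding multipartite_simps by (rule vertex_from_inj)
      show "parcs (multipartite k) \<subseteq> pverts (multipartite k) \<times> pverts (multipartite k)"
      proof
        fix e assume "e \<in> parcs (multipartite k)"
        then show "e \<in> pverts (multipartite k) \<times> pverts (multipartite k)"
          by (cases e) simp
      qed
    qed
    then show ?thesis
      by (simp only: vertex_from_0[OF assms(2)])
  qed
  have "avoiding ?G ?p ?q"
    unfolding avoiding_def
  proof (intro allI impI)
    fix i assume i: "1 \<le> i \<and> i < card (edges ?G)"
    \<comment> \<open>Position 0 holds the start vertex, so position \<open>i\<close> of the circuit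
      is position \<open>i - 1\<close> of \<open>M\<close>. The length of \<open>M\<close> is one
      less than the number of edges, which matches the bound on \<open>i\<close>.\<close>
    define j where "j = i - 1"
    have "length M + 2 = Suc (card (edges ?G))"
      using eulerian_circuit_length[OF circuit[OF M]] by simp
    then have j: "i = Suc j" "j < length M"
      using i unfolding j_def by linarith+
    have len: "length M = length N"
      using R by (rule list_all2_lengthD)
    let ?x = "M ! j" and ?y = "N ! j"
    have x: "?x \<in> {..<k} \<times> {..<4}" "?y \<in> {..<k} \<times> {..<4}"
      by (rule subsetD[OF V(1) nth_mem[OF j(2)]],
          rule subsetD[OF V(2) nth_mem[OF j(2)[unfolded len]]])
    have eq: "fst ?x = fst ?y" "?x \<noteq> ?y"
      using list_all2_nthD[OF R j(2)] by simp_all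
    have nth: "?p ! i = ?f ?x" "?q ! i = ?f ?y"
      using j len by (simp_all add: nth_append)
    have "?f ?x \<noteq> ?f ?y"
      using inj_on_eq_iff[OF vertex_from_inj x, of u] eq(2) by simp
    moreover have "?f ?x mod int k = ?f ?y mod int k"
      using eq(1) by (simp only: vertex_from_mod)
    ultimately show "?p ! i \<noteq> ?q ! i \<and> (?p ! i, ?q ! i) \<notin> parcs ?G"
      unfolding nth by simp
  qed
  then show ?thesis
    by (rule that[OF circuit[OF M] circuit[OF N]])
qed

theorem theorem3:
  fixes n :: nat
  assumes "n mod 4 = 0" and "n \<ge> 8"
  shows "\<exists>G :: int pair_pre_digraph.
           circulant_graph n G \<and> card (pverts G) = n \<and>
           regular_graph G (n - 4) \<and> doubly_eulerian G"
proof -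
  define k where "k = n div 4"
  have n: "n = 4 * k" and k: "k \<ge> 2"
    using assms by (auto simp: k_def)
  let ?G = "residue_multipartite k"
  have "\<exists>p q. eulerian_circuit ?G u p \<and> eulerian_circuit ?G u q \<and> avoiding ?G p q"
    if "u \<in> pverts ?G" for u
    using that residue_multipartite_avoiding_circuits[OF k, of u]
    unfolding residue_multipartite_simps by metis
  \<comment> \<open>The circuit at vertex 0 witnesses \<open>eulerian\<close>, which asks for a
    circuit at some vertex.\<close>
  moreover have "0 \<in> pverts ?G"
    using k by simp
  ultimately have "doubly_eulerian ?G"
    using pair_graph_residue_multipartite[of k] connected_residue_multipartite[OF k]
    unfolding doubly_eulerian_def eulerian_def by blast
  moreover have "k > 0"
    using k by simp
  ultimately show ?thesis
    using circulant_residue_multipartite[of k] regular_residue_multipartite[of k]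
    unfolding n by (intro exI[of _ ?G] conjI) simp_all
qed

end
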